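(* Let $S$ be a left cancellative monoid with neutral element $e$, and let $R$ be a ring with an $S$-grading $\Gamma: R=\bigoplus_{g\in S}R_g$ of finite support, with $d=|\mathrm{Supp}(\Gamma)|$. If $R_e$ is nilpotent with nilpotency index $\mathrm{nd}(R_e)=r\geq 1$, then $R$ is a nilpotent ring, with $r\leq\mathrm{nd}(R)\leq dr$ if $r>1$, and $r\leq \mathrm{nd}(R)\leq d+1$ if $r=1$.
   Context: Rings are associative, not necessarily with unity. A monoid $S$ is left cancellative if $gh=gt$ implies $h=t$ for all $g,h,t\in S$. An $S$-grading on $R$ is a decomposition $\Gamma: R=\bigoplus_{g\in S}R_g$ into additive subgroups with $R_gR_h\subseteq R_{gh}$ for all $g,h\in S$; its support is $\mathrm{Supp}(\Gamma)=\{g\in S: R_g\neq 0\}$. A ring $T$ is nilpotent if there is an integer $n>0$ with $a_1\cdots a_n=0$ for all $a_1,\dots,a_n\in T$ (written $T^n=\{0\}$); its nilpotency index $\mathrm{nd}(T)$ is the smallest such positive integer $n$ (so $\mathrm{nd}(T)=1$ iff $T=\{0\}$). *)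

theory Defs
  imports Main
begin

definition left_cancellative :: "'s::monoid_mult itself \<Rightarrow> bool" where
  "left_cancellative _ \<longleftrightarrow> (\<forall>g h t :: 's. g * h = g * t \<longrightarrow> h = t)"

definition additive_subgroup :: "'r::ring set \<Rightarrow> bool" where
  "additive_subgroup A \<longleftrightarrow>
     0 \<in> A \<and> (\<forall>x\<in>A. \<forall>y\<in>A. x + y \<in> A) \<and> (\<forall>x\<in>A. - x \<in> A)"

definition direct_sum_decomposition :: "('s \<Rightarrow> 'r::ring set) \<Rightarrow> bool" where
  "direct_sum_decomposition R \<longleftrightarrow>
     (\<forall>g. additive_subgroup (R g)) \<and>
     (\<forall>x. \<exists>!f. (\<forall>g. f g \<in> R g) \<and> finite {g. f g \<noteq> 0} \<and> x = (\<Sum>g | f g \<noteq> 0. f g))"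

definition grading :: "('s::monoid_mult \<Rightarrow> 'r::ring set) \<Rightarrow> bool" where
  "grading R \<longleftrightarrow> direct_sum_decomposition R \<and>
     (\<forall>g h. \<forall>x\<in>R g. \<forall>y\<in>R h. x * y \<in> R (g * h))"

definition supp :: "('s \<Rightarrow> 'r::ring set) \<Rightarrow> 's set" where
  "supp R = {g. R g \<noteq> {0}}"

text \<open>The product of a nonempty list. The library's list product is not applicable here, since
  the class of rings does not provide a unit; the value on the empty list is never used.\<close>

definition list_product :: "'r::ring list \<Rightarrow> 'r" where
  "list_product xs = foldl (*) (hd xs) (tl xs)"

definition power_vanishes :: "'r::ring set \<Rightarrow> nat \<Rightarrow> bool" where
  "power_vanishes T n \<longleftrightarrow>
     (\<forall>xs. length xs = n \<and> set xs \<subseteq> T \<longrightarrow> list_product xs = 0)"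

definition nilpotent :: "'r::ring set \<Rightarrow> bool" where
  "nilpotent T \<longleftrightarrow> (\<exists>n>0. power_vanishes T n)"

text \<open>Meaningful only for nilpotent \<open>T\<close>.\<close>

definition nd :: "'r::ring set \<Rightarrow> nat" where
  "nd T = (LEAST n. n > 0 \<and> power_vanishes T n)"

end

theory Submission
  imports Defs
begin

text \<open>By multilinearity it suffices to multiply homogeneous elements \<open>a\<^sub>0, \<dots>, a\<^sub>n\<^sub>-\<^sub>1\<close> of degrees
  \<open>g\<^sub>0, \<dots>, g\<^sub>n\<^sub>-\<^sub>1\<close>. If their product is nonzero, every partial degree \<open>g\<^sub>0 \<cdots> g\<^sub>k\<^sub>-\<^sub>1\<close> with \<open>k \<ge> 1\<close>
  lies in the support. If more than \<open>d r\<close> partial degrees lie in the support, some value is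
  attained at least \<open>r + 1\<close> times; by left cancellation, the \<open>r\<close> blocks between consecutive
  occurrences have degree \<open>1\<close>, so the product contains a product of \<open>r\<close> elements of the neutral
  component and vanishes. The empty partial degree may be counted exactly when the neutral
  component is nonzero, which accounts for the two bounds.\<close>

lemma foldl_times_left:
  fixes x :: "'r::ring"
  shows "foldl (*) (x * y) zs = x * foldl (*) y zs"
  by (induction zs arbitrary: y) (auto simp: mult.assoc)

lemma list_product_append:
  assumes "xs \<noteq> []" "ys \<noteq> []"
  shows "list_product (xs @ ys) = list_product xs * list_product ys"
  using assms by (cases ys) (auto simp: list_product_def foldl_times_left)

lemma list_product_singleton [simp]: "list_product [x] = x"
  by (simp add: list_product_def)

lemma foldl_times_sum:
  fixes f :: "'a \<Rightarrow> 'r::ring"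
  shows "foldl (*) (sum f G) zs = (\<Sum>g\<in>G. foldl (*) (f g) zs)"
proof (induction zs arbitrary: f)
  case (Cons z zs)
  show ?case using Cons[of "\<lambda>g. f g * z"] by (simp add: sum_distrib_right)
qed simp

text \<open>Distributivity in a single factor. An empty \<open>ys\<close> is treated apart because
  no unit can stand for the empty product.\<close>

lemma list_product_sum:
  fixes f :: "'a \<Rightarrow> 'r::ring"
  shows "list_product (ys @ sum f G # zs) = (\<Sum>g\<in>G. list_product (ys @ f g # zs))"
proof (cases "ys = []")
  case True
  then show ?thesis by (simp add: list_product_def foldl_times_sum)
next
  case False
  then show ?thesis
    by (simp add: list_product_append)
      (simp add: list_product_def foldl_times_sum sum_distrib_left)
qed

lemma list_product_eq_0_infix:
  assumes "list_product ys = 0" "ys \<noteq> []"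
  shows "list_product (xs @ ys @ zs) = 0"
  using assms by (cases "xs = []"; cases "zs = []") (auto simp: list_product_append)

lemma grading_decompose:
  assumes "grading R"
  obtains f where "\<And>g. f g \<in> R g" "x = (\<Sum>g | f g \<noteq> 0. f g)"
  using assms unfolding grading_def direct_sum_decomposition_def by metis

lemma power_vanishes_homogeneous:
  fixes R :: "'s::monoid_mult \<Rightarrow> 'r::ring set"
  assumes "grading R" "power_vanishes (\<Union>g. R g) n"
  shows "power_vanishes (UNIV :: 'r set) n"
proof -
  \<comment> \<open>Generalised for the induction: arbitrary prefix, homogeneous suffix. Each step
    splits the last entry of the prefix into components and moves them to the suffix.\<close>
  have "list_product (ys @ zs) = 0" if "length (ys @ zs) = n" "set zs \<subseteq> (\<Union>g. R g)" for ys zs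
    using that
  proof (induction ys arbitrary: zs rule: rev_induct)
    case Nil
    then show ?case using assms(2) by (simp add: power_vanishes_def)
  next
    case (snoc y ys)
    obtain f where f: "\<And>g. f g \<in> R g" "y = (\<Sum>g | f g \<noteq> 0. f g)"
      using grading_decompose[OF assms(1)] by blast
    have "list_product (ys @ f g # zs) = 0" for g
      using snoc.prems f(1) by (intro snoc.IH) auto
    then show ?case by (subst f(2)) (simp add: list_product_sum)
  qed
  from this[where zs = "[]"] show ?thesis by (simp add: power_vanishes_def)
qed

lemma list_product_in_component:
  assumes "grading R" "\<And>i. i < n \<Longrightarrow> a i \<in> R (g i)" "i < j" "j \<le> n"
  shows "list_product (map a [i..<j]) \<in> R (prod_list (map g [i..<j]))"
  using assms(3,4)
proof (induction j)
  case (Suc j)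
  show ?case
  proof (cases "i = j")
    case True
    then show ?thesis using Suc.prems assms(2) by simp
  next
    case False
    then show ?thesis
      using Suc assms(1,2) by (auto simp: list_product_append grading_def)
  qed
qed simp

lemma upt_append: "i \<le> j \<Longrightarrow> j \<le> k \<Longrightarrow> [i..<k] = [i..<j] @ [j..<k]"
  by (metis upt_add_eq_append le_add_diff_inverse)

text \<open>Associativity regroups a segment along the cut points \<open>f 0\<close>, ...,
  \<open>f m\<close>. The conjunct \<open>f 0 < f m\<close> is carried along because splitting off
  the last block requires a nonempty remainder.\<close>

lemma list_product_blocks:
  assumes "m > 0" "\<And>k. k < m \<Longrightarrow> f k < f (Suc k)"
  shows "f 0 < f m \<and> list_product (map a [f 0..<f m]) =
    list_product (map (\<lambda>k. list_product (map a [f k..<f (Suc k)])) [0..<m])"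
  using assms
proof (induction m)
  case (Suc m)
  show ?case
  proof (cases "m = 0")
    case True
    then show ?thesis using Suc.prems by simp
  next
    case False
    then have IH: "f 0 < f m" "list_product (map a [f 0..<f m]) =
        list_product (map (\<lambda>k. list_product (map a [f k..<f (Suc k)])) [0..<m])"
      using Suc by auto
    have step: "f m < f (Suc m)" using Suc.prems by simp
    have "[f 0..<f (Suc m)] = [f 0..<f m] @ [f m..<f (Suc m)]"
      using IH(1) step by (intro upt_append) auto
    then show ?thesis using IH step False by (simp add: list_product_append)
  qed
qed simp

lemma pigeonhole_fibre:
  assumes "finite I" "finite V" "p ` I \<subseteq> V" "card I > card V * r"
  obtains v where "card {k \<in> I. p k = v} > r"
proof -
  have "\<exists>v. card {k \<in> I. p k = v} > r"
  proof (rule ccontr)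
    assume "\<not> ?thesis"
    then have le: "\<And>v. card {k \<in> I. p k = v} \<le> r" by (simp add: not_less)
    have "card I = card (\<Union>v\<in>V. {k \<in> I. p k = v})"
      using assms(3) by (intro arg_cong[where f = card]) auto
    also have "\<dots> \<le> (\<Sum>v\<in>V. card {k \<in> I. p k = v})"
      by (rule card_UN_le) fact
    also have "\<dots> \<le> card V * r"
      using sum_bounded_above[of V "\<lambda>v. card {k \<in> I. p k = v}" r] le by simp
    finally show False using assms(4) by simp
  qed
  then show ?thesis using that by blast
qed

text \<open>\<open>I\<close> is the set of cut positions whose partial degrees are counted. Position
  \<open>0\<close> has degree \<open>1\<close>, so it may be included only when \<open>1\<close>
  lies in the support; leaving \<open>I\<close> free serves both bounds.\<close>

lemma homogeneous_product_eq_0: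
  fixes R :: "'s::monoid_mult \<Rightarrow> 'r::ring set"
  assumes lc: "left_cancellative TYPE('s)" and gr: "grading R" and fin: "finite (supp R)"
    and pv: "power_vanishes (R 1) r" and r: "r > 0"
    and hom: "\<And>i. i < n \<Longrightarrow> a i \<in> R (g i)"
    and I: "I \<subseteq> {..n}" "0 \<in> I \<Longrightarrow> 1 \<in> supp R" "card I > card (supp R) * r"
  shows "list_product (map a [0..<n]) = 0"
proof (rule ccontr)
  assume nz: "list_product (map a [0..<n]) \<noteq> 0"
  note comp = list_product_in_component[where R = R and n = n and a = a and g = g, OF gr hom]
  have seg_nz: "list_product (map a [i..<j]) \<noteq> 0" if "i < j" "j \<le> n" for i j
  proof
    assume "list_product (map a [i..<j]) = 0"
    then have "list_product (map a [0..<i] @ map a [i..<j] @ map a [j..<n]) = 0"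
      using that by (intro list_product_eq_0_infix) auto
    moreover have "[0..<n] = [0..<i] @ [i..<j] @ [j..<n]"
      using that upt_append[of 0 i n] upt_append[of i j n] by simp
    ultimately show False using nz by simp
  qed
  define p where "p k = prod_list (map g [0..<k])" for k
  have "p k \<in> supp R" if "k \<in> I" for k
  proof (cases "k = 0")
    case True
    then show ?thesis using that I(2) by (simp add: p_def)
  next
    \<comment> \<open>For \<open>k > 0\<close> the product of the first \<open>k\<close> factors is
      a nonzero element of \<open>R (p k)\<close>.\<close>
    case False
    then show ?thesis
      using seg_nz[of 0 k] comp[of 0 k] that I(1) by (auto simp: supp_def p_def)
  qed
  then have "p ` I \<subseteq> supp R" by auto
  then obtain v where v: "card {k \<in> I. p k = v} > r"
    using pigeonhole_fibre[OF _ fin _ I(3), of p] I(1) finite_subset by blast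
  define A where "A = {k \<in> I. p k = v}"
  \<comment> \<open>Increasing enumeration of the fibre. It has more than \<open>r\<close> elements,
    so the indices \<open>0\<close>, ..., \<open>r\<close> are valid and bound \<open>r\<close>
    consecutive blocks.\<close>
  define f where "f k = sorted_list_of_set A ! k" for k
  have finA: "finite A" using I(1) finite_subset by (fastforce simp: A_def)
  have len: "length (sorted_list_of_set A) > r" using v by (simp add: A_def)
  have fA: "f k \<le> n" "p (f k) = v" if "k \<le> r" for k
  proof -
    have "f k \<in> A"
      using that len finA unfolding f_def
      by (metis nth_mem set_sorted_list_of_set le_less_trans)
    then show "f k \<le> n" "p (f k) = v" using I(1) by (auto simp: A_def)
  qed
  have fless: "f k < f (Suc k)" if "k < r" for k
    unfolding f_def
    using that len sorted_wrt_nth_less[OF strict_sorted_list_of_set[of A], of k "Suc k"] by simp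
  have block: "list_product (map a [f k..<f (Suc k)]) \<in> R 1" if "k < r" for k
  proof -
    have "[0..<f (Suc k)] = [0..<f k] @ [f k..<f (Suc k)]"
      using fless[OF that] by (intro upt_append) auto
    then have "p (f (Suc k)) = p (f k) * prod_list (map g [f k..<f (Suc k)])"
      by (simp add: p_def)
    \<comment> \<open>Both ends of the block have partial degree \<open>v\<close>, so
      \<open>v\<close> can be cancelled on the left.\<close>
    then have "v * prod_list (map g [f k..<f (Suc k)]) = v * 1"
      using fA[of k] fA[of "Suc k"] that by simp
    then have "prod_list (map g [f k..<f (Suc k)]) = 1"
      using lc unfolding left_cancellative_def by blast
    then show ?thesis
      using comp[of "f k" "f (Suc k)"] fless[OF that] fA(1)[of "Suc k"] that by auto
  qed
  \<comment> \<open>A product of \<open>r\<close> elements of \<open>R 1\<close>; regrouped, it is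
    the segment from \<open>f 0\<close> to \<open>f r\<close>, which is nonzero by
    \<open>seg_nz\<close>.\<close>
  then have "list_product (map (\<lambda>k. list_product (map a [f k..<f (Suc k)])) [0..<r]) = 0"
    by (intro pv[unfolded power_vanishes_def, rule_format]) auto
  with list_product_blocks[OF r, of f a] fless seg_nz[of "f 0" "f r"] fA(1)[of r]
  show False by simp
qed

lemma power_vanishes_UNIV:
  fixes R :: "'s::monoid_mult \<Rightarrow> 'r::ring set"
  assumes "left_cancellative TYPE('s)" "grading R" "finite (supp R)"
    and "power_vanishes (R 1) r" "r > 0"
    and "I \<subseteq> {..n}" "0 \<in> I \<Longrightarrow> 1 \<in> supp R" "card I > card (supp R) * r"
  shows "power_vanishes (UNIV :: 'r set) n"
proof (rule power_vanishes_homogeneous[OF assms(2)])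
  show "power_vanishes (\<Union>g. R g) n"
    unfolding power_vanishes_def
  proof (intro allI impI)
    fix xs assume xs: "length xs = n \<and> set xs \<subseteq> (\<Union>g. R g)"
    then have "\<forall>i. \<exists>g. i < n \<longrightarrow> xs ! i \<in> R g"
      using nth_mem by blast
    then obtain g where g: "\<And>i. i < n \<Longrightarrow> xs ! i \<in> R (g i)" by metis
    have "list_product (map ((!) xs) [0..<n]) = 0"
      by (rule homogeneous_product_eq_0[OF assms(1-5) g assms(6-8)])
    then show "list_product xs = 0" using xs map_nth[of xs] by simp
  qed
qed

lemma nd_le: "n > 0 \<Longrightarrow> power_vanishes T n \<Longrightarrow> nd T \<le> n"
  unfolding nd_def by (rule Least_le) simp

lemma nd_vanishes:
  assumes "nilpotent T"
  shows "nd T > 0" "power_vanishes T (nd T)"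
  using assms LeastI_ex[of "\<lambda>n. n > 0 \<and> power_vanishes T n"]
  unfolding nilpotent_def nd_def by auto

lemma nd_mono:
  assumes "nilpotent T" "U \<subseteq> T"
  shows "nd U \<le> nd T"
proof (rule nd_le)
  show "power_vanishes U (nd T)"
    using nd_vanishes(2)[OF assms(1)] assms(2) unfolding power_vanishes_def by blast
qed (rule nd_vanishes(1)[OF assms(1)])

lemma nd_zero: "nd {0 :: 'r::ring} = 1"
proof -
  have "power_vanishes {0 :: 'r} 1"
    by (auto simp: power_vanishes_def length_Suc_conv)
  then have "nd {0 :: 'r} \<le> 1" by (intro nd_le) auto
  moreover have "nilpotent {0 :: 'r}"
    using \<open>power_vanishes {0 :: 'r} 1\<close> unfolding nilpotent_def by (intro exI[of _ 1]) simp
  ultimately show ?thesis using nd_vanishes(1)[of "{0 :: 'r}"] by simp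
qed

theorem theorem3p9:
  fixes R :: "'s::monoid_mult \<Rightarrow> 'r::ring set"
    and d r :: nat
  assumes "left_cancellative TYPE('s)"
    and "grading R"
    and "finite (supp R)"
    and "d = card (supp R)"
    and "nilpotent (R 1)"
    and "nd (R 1) = r"
    and "r \<ge> 1"
  shows "nilpotent (UNIV :: 'r set) \<and>
    (r > 1 \<longrightarrow> r \<le> nd (UNIV :: 'r set) \<and> nd (UNIV :: 'r set) \<le> d * r) \<and>
    (r = 1 \<longrightarrow> r \<le> nd (UNIV :: 'r set) \<and> nd (UNIV :: 'r set) \<le> d + 1)"
proof -
  have pv: "power_vanishes (R 1) r" using nd_vanishes(2)[OF assms(5)] assms(6) by simp
  have r: "r > 0" using assms(7) by simp
  note vanish = power_vanishes_UNIV[OF assms(1-3) pv r]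
  \<comment> \<open>Chosen so that the counted positions exceed \<open>d * r\<close> by exactly one:
    \<open>{1..n}\<close> has \<open>d + 1\<close> elements if \<open>r = 1\<close>, and
    \<open>{..n}\<close> has \<open>d * r + 1\<close> otherwise.\<close>
  define n where "n = (if r = 1 then d + 1 else d * r)"
  have n: "n > 0 \<and> power_vanishes (UNIV :: 'r set) n"
  proof (cases "r = 1")
    case True
    then show ?thesis
      using vanish[of "{1..n}" n] assms(4) by (auto simp: n_def)
  next
    case False
    \<comment> \<open>The zero ring has index 1, so \<open>R 1\<close> is nonzero and position
      \<open>0\<close> may be counted.\<close>
    then have one: "1 \<in> supp R"
      using assms(6) nd_zero by (auto simp: supp_def)
    then have "d > 0" using assms(3,4) card_gt_0_iff by blast
    then show ?thesis
      using vanish[of "{..n}" n] one False r assms(4) by (auto simp: n_def)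
  qed
  then have nil: "nilpotent (UNIV :: 'r set)" unfolding nilpotent_def by blast
  have "r \<le> nd (UNIV :: 'r set)" using nd_mono[OF nil, of "R 1"] assms(6) by simp
  moreover have "nd (UNIV :: 'r set) \<le> n" using n nd_le by blast
  ultimately show ?thesis using nil by (auto simp: n_def)
qed

end
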